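(* There is a constant $c>0$ and an integer $n_0$ such that for every integer $n\ge n_0$ and every probability distribution $\mu$ on $\{1,\dots,n\}$ we have $\mathbf{E}_\mu(T)\ge c(\log n)^2$. In other words, $\mathbf{E}_\mu(T)=\Omega((\log n)^2)$ for all distributions $\mu$.
   Context: Let $n$ be a positive integer and $\mu$ a probability distribution on $\{1,\dots,n\}$. Consider the Markov chain $R=(R_0,R_1,\dots)$ on the state space $\{0,1,\dots,n\}$: $R_0$ is chosen uniformly at random from $\{1,\dots,n\}$; in round $t\ge1$, if $R_{t-1}=a$, a value $d$ is drawn from $\mu$ (independently of everything else); if $d\le a$ then $R_t=a-d$, otherwise $R_t=a$. Let $T=\min\{t\mid R_t=0\}$ (with $T=\infty$ if $0$ is never reached) and let $\mathbf{E}_\mu(T)$ denote its expectation (possibly $\infty$). Asymptotic notation refers to $n\to\infty$; $\log$ is the logarithm to base 2. *)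

theory Defs
  imports "HOL-Probability.Probability"
begin

(* Trajectory started in a; the value drawn in round t + 1 is ds !! t. *)
fun chain :: "nat \<Rightarrow> nat stream \<Rightarrow> nat \<Rightarrow> nat" where
  "chain a ds 0 = a"
| "chain a ds (Suc t) =
     (if ds !! t \<le> chain a ds t then chain a ds t - ds !! t else chain a ds t)"

definition hitting_time :: "nat \<Rightarrow> nat stream \<Rightarrow> enat" where
  "hitting_time a ds =
     (if \<exists>t. chain a ds t = 0 then enat (LEAST t. chain a ds t = 0) else \<infinity>)"

(* Canonical probability space: a uniform starting point in {1..n} together with an
   independent i.i.d. sequence of draws from mu. *)
definition chain_space :: "nat \<Rightarrow> nat pmf \<Rightarrow> (nat \<times> nat stream) measure" where
  "chain_space n \<mu> =
     measure_pmf (pmf_of_set {1..n}) \<Otimes>\<^sub>M stream_space (measure_pmf \<mu>)"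

definition expected_time :: "nat \<Rightarrow> nat pmf \<Rightarrow> ennreal" where
  "expected_time n \<mu> =
     (\<integral>\<^sup>+ (a, ds). ennreal_of_enat (hitting_time a ds) \<partial>chain_space n \<mu>)"

lemma measurable_chain:
  "(\<lambda>(a, ds). chain a ds t) \<in> chain_space n \<mu> \<rightarrow>\<^sub>M count_space UNIV"
proof (induction t)
  case 0
  show ?case unfolding chain_space_def case_prod_beta' chain.simps by measurable
next
  case (Suc t)
  define f :: "nat \<times> nat stream \<Rightarrow> nat" where "f = (\<lambda>x. chain (fst x) (snd x) t)"
  define g :: "nat \<times> nat stream \<Rightarrow> nat" where "g = (\<lambda>x. snd x !! t)"
  have [measurable]: "f \<in> chain_space n \<mu> \<rightarrow>\<^sub>M count_space UNIV"
    using Suc by (simp add: f_def case_prod_beta')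
  have [measurable]: "g \<in> chain_space n \<mu> \<rightarrow>\<^sub>M count_space UNIV"
    unfolding chain_space_def g_def by measurable
  have "(\<lambda>x. if d \<le> f x then f x - d else f x) \<in> chain_space n \<mu> \<rightarrow>\<^sub>M count_space UNIV" for d
    by (rule measurable_compose[where f = f and N = "count_space UNIV"]) simp_all
  then have "(\<lambda>x. if g x \<le> f x then f x - g x else f x) \<in> chain_space n \<mu> \<rightarrow>\<^sub>M count_space UNIV"
    by (rule measurable_compose_countable) simp
  then show ?case unfolding f_def g_def case_prod_beta' chain.simps .
qed

(* Hence the nonnegative integral in expected_time is a genuine expectation. *)
lemma measurable_hitting_time:
  "(\<lambda>(a, ds). hitting_time a ds) \<in> chain_space n \<mu> \<rightarrow>\<^sub>M count_space UNIV"
proof -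
  define f :: "nat \<Rightarrow> nat \<times> nat stream \<Rightarrow> nat" where "f = (\<lambda>t x. chain (fst x) (snd x) t)"
  have [measurable]: "f t \<in> chain_space n \<mu> \<rightarrow>\<^sub>M count_space UNIV" for t
    using measurable_chain by (simp add: f_def case_prod_beta')
  have "(\<lambda>x. if \<exists>t. f t x = 0 then enat (LEAST t. f t x = 0) else \<infinity>)
      \<in> chain_space n \<mu> \<rightarrow>\<^sub>M count_space UNIV"
    by measurable
  then show ?thesis unfolding f_def hitting_time_def case_prod_beta' .
qed

end

theory Submission
  imports Defs
begin

text \<open>
  Start the token uniformly on \<open>L\<close> consecutive positions \<open>{0..<L}\<close>. A draw \<open>d < L\<close> makes it uniform on
  \<open>{0..<d}\<close> with probability \<open>d / L\<close>, and uniform on \<open>{0..<L - d}\<close> otherwise. Hence it suffices to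
  study the length \<open>L\<close>. Let \<open>r x\<close> be the average of \<open>sqrt (min (d / x) (x / d))\<close> over \<open>d\<close>,
  a smoothed rate at which draws shrink intervals of length about \<open>x\<close>. The potential
  \<open>\<Phi> L = (\<Sum>x<L. 1 / (x * r x))\<close> decreases by only a bounded amount per round in expectation, since \<open>r\<close>
  varies slowly on the logarithmic scale. By Cauchy-Schwarz, \<open>\<Phi> n\<close> is at least
  \<open>(\<Sum>x<n. 1 / x)\<^sup>2 / (\<Sum>x<n. r x / x)\<close>, and the denominator is bounded independently of the distribution.
\<close>

section \<open>Power sums and the kernel \<open>proximity\<close>\<close>

lemma sum_inverse_sqrt_le: "(\<Sum>x\<in>{1..m}. 1 / sqrt (real x)) \<le> 2 * sqrt (real m)"
proof (induction m)
  case (Suc m)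
  define u v where "u = sqrt (real m)" and "v = sqrt (real (Suc m))"
  have uv: "0 \<le> u" "0 < v" "v * v = u * u + 1" by (auto simp: u_def v_def)
  \<comment> \<open>Since \<open>v * v = u * u + 1\<close>, this square yields the telescoping bound
    \<open>1 / v \<le> 2 * v - 2 * u\<close>.\<close>
  have "(u - v)\<^sup>2 \<ge> 0" by simp
  then have "1 \<le> (2 * v - 2 * u) * v"
    using uv by (simp add: algebra_simps power2_eq_square)
  then have "1 / v \<le> 2 * v - 2 * u" using uv by (simp add: pos_divide_le_eq)
  then show ?case using Suc by (simp add: u_def v_def)
qed simp

text \<open>Telescoping again: with u = sqrt L and v = sqrt (L + 1), each term satisfies 1 / u^3
  \<le> 4 / u - 4 / v. The corresponding integral has 2 in place of 4, but a left-endpoint sum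
  exceeds the integral.\<close>

lemma sum_inverse_power_three_halves_le:
  assumes "0 < e" "e \<le> L"
  shows "(\<Sum>x\<in>{e..<L}. 1 / (real x * sqrt (real x))) \<le> 4 / sqrt (real e) - 4 / sqrt (real L)"
  using assms(2)
proof (induction L rule: dec_induct)
  case (step L)
  define u v where "u = sqrt (real L)" and "v = sqrt (real (Suc L))"
  have uv: "1 \<le> u" "0 < v" "u < v" "v * v = u * u + 1" "real L = u * u"
    using assms(1) step by (auto simp: u_def v_def)
  have "v * v \<le> 2 * (u * u)" using uv mult_mono[of 1 u 1 u] by simp
  moreover have "2 * (u * v) \<le> u * u + v * v"
    using sum_squares_bound[of u v] by (simp add: power2_eq_square)
  ultimately have le: "v * (u + v) \<le> 4 * (u * u)"
    unfolding distrib_left mult.commute[of v u] using zero_le_square[of u] by linarith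
  have "1 / (u * u * u) = 4 / (u * (4 * (u * u)))" using uv by (simp add: field_simps)
  also have "\<dots> \<le> 4 / (u * (v * (u + v)))"
    using uv le by (intro divide_left_mono mult_left_mono mult_pos_pos) auto
  also have "\<dots> = (v - u) * 4 / ((v - u) * (u * (v * (u + v))))"
    using uv by (intro nonzero_mult_divide_mult_cancel_left[symmetric]) simp
  also have "(v - u) * (u * (v * (u + v))) = u * v * ((v - u) * (u + v))" by (simp only: mult_ac)
  also have "(v - u) * (u + v) = 1" using uv by (simp add: algebra_simps)
  also have "(v - u) * 4 / (u * v * 1) = 4 / u - 4 / v" using uv by (simp add: field_simps)
  finally show ?case using step by (simp add: u_def v_def)
qed simp

text \<open>For positive arguments this is exp (- |ln d - ln x| / 2), a symmetric bump on the
  logarithmic scale. With the square root, \<open>L * proximity d L\<close> equals sqrt (d * L) for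
  d \<le> L, which up to the factor 1 / \<open>rate L\<close> is the size of the bound on the
  potential drop caused by a draw d.\<close>

definition proximity :: "nat \<Rightarrow> nat \<Rightarrow> real" where
  "proximity d x = sqrt (min (real d / real x) (real x / real d))"

lemma proximity_nonneg: "0 \<le> proximity d x"
  by (simp add: proximity_def)

lemma proximity_pos: "0 < d \<Longrightarrow> 0 < x \<Longrightarrow> 0 < proximity d x"
  by (simp add: proximity_def)

text \<open>Multiplying both arguments of the minimum at L by x / L turns L / d into exactly x / d,
  and d / L into at most d / x because x \<le> L.\<close>

lemma proximity_scale:
  assumes "0 < d" "0 < x" "x \<le> L"
  shows "sqrt (real x / real L) * proximity d L \<le> proximity d x"
proof -
  have "real x / real L * (real d / real L) \<le> real d / real x"
  proof -
    have "real x * real x \<le> real L * real L" using assms by (intro mult_mono) auto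
    then show ?thesis using assms by (simp add: field_simps)
  qed
  moreover have "real x / real L * (real L / real d) = real x / real d"
    using assms by simp
  moreover have "real x / real L * min (real d / real L) (real L / real d)
      = min (real x / real L * (real d / real L)) (real x / real L * (real L / real d))"
    by (simp add: min_mult_distrib_left)
  ultimately have "real x / real L * min (real d / real L) (real L / real d)
      \<le> min (real d / real x) (real x / real d)"
    by linarith
  then show ?thesis unfolding proximity_def real_sqrt_mult[symmetric] by (rule real_sqrt_le_mono)
qed

text \<open>Below d the terms are at most d^(-1/2) x^(-1/2), from d on at most d^(1/2) x^(-3/2). The
  two power sums contribute at most 2 and 4, whatever d is.\<close>

lemma sum_proximity_over_le:
  assumes "0 < d" "d \<le> n"
  shows "(\<Sum>x\<in>{1..n}. proximity d x / real x) \<le> 6"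
proof -
  have low: "proximity d x / real x \<le> 1 / sqrt (real d) * (1 / sqrt (real x))" if "0 < x" for x
  proof -
    have "proximity d x \<le> sqrt (real x / real d)" by (simp add: proximity_def)
    then have "proximity d x / real x \<le> sqrt (real x / real d) / real x"
      by (intro divide_right_mono) auto
    also have "\<dots> = 1 / sqrt (real d) * (sqrt (real x) / real x)"
      by (simp add: real_sqrt_divide)
    also have "sqrt (real x) / real x = 1 / sqrt (real x)"
      using that by (simp add: field_simps)
    finally show ?thesis .
  qed
  have high: "proximity d x / real x \<le> sqrt (real d) * (1 / (real x * sqrt (real x)))" if "0 < x" for x
  proof -
    have "proximity d x \<le> sqrt (real d / real x)" by (simp add: proximity_def)
    then have "proximity d x / real x \<le> sqrt (real d / real x) / real x"
      by (intro divide_right_mono) auto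
    then show ?thesis by (simp add: real_sqrt_divide mult.commute)
  qed
  have "(\<Sum>x\<in>{1..n}. proximity d x / real x)
      = (\<Sum>x\<in>{1..<d}. proximity d x / real x) + (\<Sum>x\<in>{d..<Suc n}. proximity d x / real x)"
    using assms by (simp add: sum.atLeastLessThan_concat flip: atLeastLessThanSuc_atLeastAtMost)
  also have "(\<Sum>x\<in>{1..<d}. proximity d x / real x) \<le> (\<Sum>x\<in>{1..d}. proximity d x / real x)"
    by (intro sum_mono2) (auto simp: proximity_nonneg)
  also have "\<dots> \<le> (\<Sum>x\<in>{1..d}. 1 / sqrt (real d) * (1 / sqrt (real x)))"
    by (intro sum_mono low) auto
  also have "\<dots> \<le> 1 / sqrt (real d) * (2 * sqrt (real d))"
    unfolding sum_distrib_left[symmetric] by (intro mult_left_mono sum_inverse_sqrt_le) auto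
  also have "\<dots> = 2" using assms by simp
  also have "(\<Sum>x\<in>{d..<Suc n}. proximity d x / real x)
      \<le> (\<Sum>x\<in>{d..<Suc n}. sqrt (real d) * (1 / (real x * sqrt (real x))))"
    using assms by (intro sum_mono high) auto
  also have "\<dots> \<le> sqrt (real d) * (4 / sqrt (real d) - 4 / sqrt (real (Suc n)))"
    unfolding sum_distrib_left[symmetric] using assms
    by (intro mult_left_mono sum_inverse_power_three_halves_le) auto
  also have "\<dots> \<le> sqrt (real d) * (4 / sqrt (real d))"
    by (intro mult_left_mono) auto
  also have "\<dots> = 4" using assms by simp
  finally show ?thesis by simp
qed

section \<open>Rate and potential of a distribution\<close>

locale step_weights =
  fixes p :: "nat \<Rightarrow> real" and n :: nat
  assumes p_nonneg: "0 \<le> p d"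
    and sum_p: "(\<Sum>d\<in>{1..n}. p d) = 1"
begin

definition rate :: "nat \<Rightarrow> real" where
  "rate x = (\<Sum>d\<in>{1..n}. p d * proximity d x)"

text \<open>Discrete form of the integral of d(ln x) / \<open>rate x\<close>, the time to traverse
  the logarithmic scale at speed \<open>rate\<close>. The upper end is exclusive, so
  \<open>potential 1 = 0\<close>.\<close>

definition potential :: "nat \<Rightarrow> real" where
  "potential L = (\<Sum>x\<in>{1..<L}. 1 / (real x * rate x))"

lemma rate_pos:
  assumes "0 < x"
  shows "0 < rate x"
proof -
  obtain d where d: "d \<in> {1..n}" "p d \<noteq> 0"
    using sum_p by (metis sum.neutral zero_neq_one)
  then have "0 < p d * proximity d x"
    using assms p_nonneg[of d] by (auto intro!: mult_pos_pos proximity_pos)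
  then show ?thesis
    unfolding rate_def using d by (intro sum_pos2[of _ d]) (auto intro!: mult_nonneg_nonneg p_nonneg proximity_nonneg)
qed

lemma rate_scale:
  assumes "0 < x" "x \<le> L"
  shows "sqrt (real x / real L) * rate L \<le> rate x"
  unfolding rate_def sum_distrib_left
proof (rule sum_mono)
  fix d assume "d \<in> {1..n}"
  then have "p d * (sqrt (real x / real L) * proximity d L) \<le> p d * proximity d x"
    using assms by (intro mult_left_mono proximity_scale p_nonneg) auto
  then show "sqrt (real x / real L) * (p d * proximity d L) \<le> p d * proximity d x"
    by (simp add: mult_ac)
qed

text \<open>Expresses the term at x through the rate at L, so that potential differences reduce to
  power sums with the common factor 1 / \<open>rate L\<close>.\<close>

lemma potential_term_le:
  assumes "0 < x" "x \<le> L"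
  shows "1 / (real x * rate x) \<le> sqrt (real L) / rate L * (1 / (real x * sqrt (real x)))"
proof -
  have "0 < sqrt (real x / real L) * rate L"
    using assms rate_pos[of L] by simp
  then have "1 / (real x * rate x) \<le> 1 / (real x * (sqrt (real x / real L) * rate L))"
    using assms rate_scale[of x L] rate_pos[of x] rate_pos[of L]
    by (intro divide_left_mono mult_left_mono mult_pos_pos) auto
  also have "\<dots> = sqrt (real L) / rate L * (1 / (real x * sqrt (real x)))"
    by (simp add: real_sqrt_divide)
  finally show ?thesis .
qed

lemma potential_diff:
  assumes "0 < e" "e \<le> L"
  shows "potential L - potential e = (\<Sum>x\<in>{e..<L}. 1 / (real x * rate x))"
proof -
  have "potential L = potential e + (\<Sum>x\<in>{e..<L}. 1 / (real x * rate x))"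
    unfolding potential_def using assms by (intro sum.atLeastLessThan_concat[symmetric]) auto
  then show ?thesis by simp
qed

text \<open>Obtained by summing the x^(-3/2) bound over the whole range. This estimate does not
  become small as e approaches L; the next one does.\<close>

lemma potential_diff_le_sqrt:
  assumes "0 < e" "e \<le> L"
  shows "real e * (potential L - potential e) \<le> 4 * sqrt (real e * real L) / rate L"
proof -
  have "potential L - potential e
      \<le> sqrt (real L) / rate L * (\<Sum>x\<in>{e..<L}. 1 / (real x * sqrt (real x)))"
    unfolding potential_diff[OF assms] sum_distrib_left
    using assms by (intro sum_mono potential_term_le) auto
  also have "\<dots> \<le> sqrt (real L) / rate L * (4 / sqrt (real e))"
    using assms sum_inverse_power_three_halves_le[OF assms] rate_pos[of L]
    by (intro mult_left_mono) (auto intro: order_trans)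
  finally have "real e * (potential L - potential e)
      \<le> real e * (sqrt (real L) / rate L * (4 / sqrt (real e)))"
    by (intro mult_left_mono) auto
  also have "\<dots> = 4 * (real e / sqrt (real e)) * sqrt (real L) / rate L"
    by (simp add: mult_ac)
  also have "real e / sqrt (real e) = sqrt (real e)" by (rule real_div_sqrt) simp
  finally show ?thesis by (simp add: real_sqrt_mult)
qed

text \<open>Every term is bounded by the value of the power bound at x = e, so the number L - e of
  terms becomes a factor.\<close>

lemma potential_diff_le_linear:
  assumes "0 < e" "e \<le> L"
  shows "real e * (potential L - potential e) \<le> real (L - e) * sqrt (real L / real e) / rate L"
proof -
  have "potential L - potential e \<le> (\<Sum>x\<in>{e..<L}. sqrt (real L) / rate L * (1 / (real e * sqrt (real e))))"
    unfolding potential_diff[OF assms]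
  proof (rule sum_mono)
    fix x assume x: "x \<in> {e..<L}"
    then have "1 / (real x * sqrt (real x)) \<le> 1 / (real e * sqrt (real e))"
      using assms by (intro divide_left_mono mult_mono mult_pos_pos) auto
    then have "sqrt (real L) / rate L * (1 / (real x * sqrt (real x)))
        \<le> sqrt (real L) / rate L * (1 / (real e * sqrt (real e)))"
      using assms rate_pos[of L] by (intro mult_left_mono) auto
    then show "1 / (real x * rate x) \<le> sqrt (real L) / rate L * (1 / (real e * sqrt (real e)))"
      using potential_term_le[of x L] assms x by simp
  qed
  then have "real e * (potential L - potential e)
      \<le> real e * (real (L - e) * (sqrt (real L) / rate L * (1 / (real e * sqrt (real e)))))"
    by (intro mult_left_mono) auto
  also have "\<dots> = real (L - e) * sqrt (real L / real e) / rate L"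
    using assms by (simp add: real_sqrt_divide)
  finally show ?thesis .
qed

text \<open>A draw d leaves pieces of lengths d and L - d. Weighted by its length, each loses at
  most 4 sqrt (d * L) / \<open>rate L\<close>.\<close>

lemma potential_drop_le:
  assumes "0 < d" "d < L"
  shows "real d * (potential L - potential d) + real (L - d) * (potential L - potential (L - d))
      \<le> 8 * real L * proximity d L / rate L"
proof -
  have L: "0 < rate L" using assms by (simp add: rate_pos)
  have "real d * real d \<le> real L * real L" using assms by (intro mult_mono) auto
  then have "min (real d / real L) (real L / real d) = real d / real L"
    using assms by (simp add: min_def field_simps)
  then have "real L * proximity d L = real L / sqrt (real L) * sqrt (real d)"
    by (simp add: proximity_def real_sqrt_divide)
  also have "real L / sqrt (real L) = sqrt (real L)" by (rule real_div_sqrt) simp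
  finally have prox: "real L * proximity d L = sqrt (real d * real L)"
    by (simp add: real_sqrt_mult)
  have "real (L - d) * (potential L - potential (L - d)) \<le> 4 * sqrt (real d * real L) / rate L"
  proof (cases "L - d \<le> d")
    case True
    have "4 * sqrt (real (L - d) * real L) / rate L \<le> 4 * sqrt (real d * real L) / rate L"
      using True L by (intro divide_right_mono mult_left_mono real_sqrt_le_mono mult_right_mono) auto
    then show ?thesis using potential_diff_le_sqrt[of "L - d" L] assms by simp
  next
    case False
    \<comment> \<open>The remaining piece is longer than d. The linear bound carries the factor L -
      (L - d) = d, and L / (L - d) \<le> L / d.\<close>
    have "real d * sqrt (real L / real (L - d)) \<le> real d * sqrt (real L / real d)"
      using False assms
      by (intro mult_left_mono real_sqrt_le_mono divide_left_mono mult_pos_pos) auto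
    also have "\<dots> = real d / sqrt (real d) * sqrt (real L)" by (simp add: real_sqrt_divide)
    also have "\<dots> = sqrt (real d * real L)" by (simp only: real_div_sqrt of_nat_0_le_iff real_sqrt_mult)
    also have "\<dots> \<le> 4 * sqrt (real d * real L)" by simp
    finally have "real d * sqrt (real L / real (L - d)) / rate L \<le> 4 * sqrt (real d * real L) / rate L"
      using L by (intro divide_right_mono) auto
    then show ?thesis using potential_diff_le_linear[of "L - d" L] assms by simp
  qed
  moreover have "real d * (potential L - potential d) \<le> 4 * sqrt (real d * real L) / rate L"
    using potential_diff_le_sqrt[of d L] assms by simp
  ultimately show ?thesis using prox by (simp add: mult.assoc)
qed

text \<open>Averaging \<open>proximity d L\<close> over the draws below L gives at most
  \<open>rate L\<close>, which cancels the denominator; this motivates the definition of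
  \<open>rate\<close>. Divided by L, the bound says that the expected drop in one round is at most
  8.\<close>

lemma expected_potential_drop_le:
  assumes "0 < L" "L \<le> Suc n"
  shows "(\<Sum>d\<in>{1..<L}. p d * (real d * (potential L - potential d)
            + real (L - d) * (potential L - potential (L - d)))) \<le> 8 * real L"
proof -
  have L: "0 < rate L" using assms by (simp add: rate_pos)
  have "(\<Sum>d\<in>{1..<L}. p d * (real d * (potential L - potential d)
            + real (L - d) * (potential L - potential (L - d))))
      \<le> (\<Sum>d\<in>{1..<L}. p d * (8 * real L * proximity d L / rate L))"
    by (intro sum_mono mult_left_mono potential_drop_le p_nonneg) auto
  also have "\<dots> \<le> (\<Sum>d\<in>{1..n}. p d * (8 * real L * proximity d L / rate L))"
    using assms L
    by (intro sum_mono2) (auto intro!: mult_nonneg_nonneg divide_nonneg_pos p_nonneg proximity_nonneg)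
  also have "\<dots> = 8 * real L / rate L * rate L"
    unfolding rate_def[of L] sum_distrib_left by (intro sum.cong refl) (simp add: mult_ac)
  also have "\<dots> = 8 * real L" using L by simp
  finally show ?thesis .
qed

lemma potential_ge:
  assumes "0 < n"
  shows "(ln (real n))\<^sup>2 / 6 \<le> potential (Suc n)"
proof -
  define r where "r x = rate x / real x" for x
  have r: "0 < r x" if "0 < x" for x using that by (simp add: r_def rate_pos)
  have "(\<Sum>x\<in>{1..n}. r x) = (\<Sum>x\<in>{1..n}. \<Sum>d\<in>{1..n}. p d * (proximity d x / real x))"
    by (simp add: r_def rate_def sum_divide_distrib)
  \<comment> \<open>After the swap the inner sum is at most 6 for each d, and averaging over d
    preserves this.\<close>
  also have "\<dots> = (\<Sum>d\<in>{1..n}. p d * (\<Sum>x\<in>{1..n}. proximity d x / real x))"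
    by (subst sum.swap) (simp add: sum_distrib_left)
  also have "\<dots> \<le> (\<Sum>d\<in>{1..n}. p d * 6)"
    by (intro sum_mono mult_left_mono sum_proximity_over_le p_nonneg) auto
  also have "\<dots> = 6" using sum_p by (simp flip: sum_distrib_right)
  finally have r6: "(\<Sum>x\<in>{1..n}. r x) \<le> 6" .
  have pot: "potential (Suc n) = (\<Sum>x\<in>{1..n}. (1 / sqrt (real x * rate x))\<^sup>2)"
    unfolding potential_def atLeastLessThanSuc_atLeastAtMost
    by (intro sum.cong refl) (auto simp: power_divide rate_pos less_imp_le)
  have "ln (real n) \<le> ln (real n + 1)" using assms by simp
  also have "\<dots> \<le> harm n" by (rule harm_ge_ln)
  finally have "ln (real n) \<le> (\<Sum>x\<in>{1..n}. 1 / real x)" by (simp add: harm_def field_simps)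
  then have "(ln (real n))\<^sup>2 \<le> (\<Sum>x\<in>{1..n}. 1 / real x)\<^sup>2"
    using assms by (intro power_mono) auto
  \<comment> \<open>Factors for Cauchy-Schwarz: the rate cancels in the product, the squares of the
    first factor sum to at most 6 and those of the second to the potential.\<close>
  also have "(\<Sum>x\<in>{1..n}. 1 / real x) = (\<Sum>x\<in>{1..n}. sqrt (r x) * (1 / sqrt (real x * rate x)))"
  proof (intro sum.cong refl)
    fix x assume "x \<in> {1..n}"
    then have "0 < x" by simp
    then show "1 / real x = sqrt (r x) * (1 / sqrt (real x * rate x))"
      using rate_pos[of x] by (simp add: r_def real_sqrt_mult real_sqrt_divide)
  qed
  also have "(\<dots>)\<^sup>2 \<le> (\<Sum>x\<in>{1..n}. (sqrt (r x))\<^sup>2) * (\<Sum>x\<in>{1..n}. (1 / sqrt (real x * rate x))\<^sup>2)"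
    by (rule Cauchy_Schwarz_ineq_sum)
  also have "(\<Sum>x\<in>{1..n}. (sqrt (r x))\<^sup>2) = (\<Sum>x\<in>{1..n}. r x)"
    by (intro sum.cong refl) (auto simp: r less_imp_le)
  also have "\<dots> * (\<Sum>x\<in>{1..n}. (1 / sqrt (real x * rate x))\<^sup>2) \<le> 6 * potential (Suc n)"
    unfolding pot using r6 by (intro mult_right_mono sum_nonneg) auto
  finally show ?thesis by simp
qed

section \<open>Comparison of expected times with the potential\<close>

text \<open>\<open>e\<close> abstracts the expected hitting times when all of them are finite: any
  real solution of the first-step equations.\<close>

context
  fixes e :: "nat \<Rightarrow> real"
  assumes e_0: "e 0 = 0"
    and e_step: "a \<in> {1..n} \<Longrightarrow> e a = 1 + (\<Sum>d\<in>{1..n}. p d * e (if d \<le> a then a - d else a))"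
begin

text \<open>Positions below d stay and fill \<open>{0..<d}\<close>; the others are shifted onto
  \<open>{0..<L - d}\<close>. Hence sums over initial segments lead again to sums over initial
  segments.\<close>

lemma prefix_sum_split:
  assumes "d < L"
  shows "(\<Sum>a<L. e (if d \<le> a then a - d else a)) = sum e {..<d} + sum e {..<L - d}"
proof -
  have "(\<Sum>a<L. e (if d \<le> a then a - d else a))
      = (\<Sum>a\<in>{0..<d}. e (if d \<le> a then a - d else a)) + (\<Sum>a\<in>{d..<L}. e (if d \<le> a then a - d else a))"
    unfolding lessThan_atLeast0 using assms by (intro sum.atLeastLessThan_concat[symmetric]) auto
  also have "(\<Sum>a\<in>{d..<L}. e (if d \<le> a then a - d else a)) = (\<Sum>a\<in>{d..<L}. e (a - d))"
    by (intro sum.cong) auto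
  also have "\<dots> = (\<Sum>a\<in>{0..<L - d}. e a)"
    using assms sum.shift_bounds_nat_ivl[of "\<lambda>a. e (a - d)" 0 d "L - d"] by simp
  finally show ?thesis by (simp add: lessThan_atLeast0)
qed

text \<open>Sums the first-step equations over a segment. Each position from 1 to L - 1 contributes
  one round and position 0 none, hence L - 1.\<close>

lemma prefix_sum_recurrence:
  assumes "0 < L" "L \<le> Suc n"
  shows "(\<Sum>d\<in>{1..<L}. p d * (sum e {..<L} - sum e {..<d} - sum e {..<L - d})) = real (L - 1)"
proof -
  let ?s = "\<lambda>d a. if d \<le> a then a - d else a"
  have split: "{..<L} = insert 0 {1..<L}" using assms by auto
  \<comment> \<open>Position 0 is fixed by every draw and \<open>e 0 = 0\<close>, so it can be added
    to complete the segment.\<close>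
  have all: "(\<Sum>a<L. e (?s d a)) = (\<Sum>a\<in>{1..<L}. e (?s d a))" if "d \<in> {1..n}" for d
    using that by (simp add: split e_0)
  have "sum e {..<L} = (\<Sum>a\<in>{1..<L}. e a)" by (simp add: split e_0)
  also have "\<dots> = (\<Sum>a\<in>{1..<L}. 1 + (\<Sum>d\<in>{1..n}. p d * e (?s d a)))"
    using assms by (intro sum.cong refl e_step) auto
  also have "\<dots> = real (L - 1) + (\<Sum>d\<in>{1..n}. p d * (\<Sum>a\<in>{1..<L}. e (?s d a)))"
    unfolding sum.distrib sum_distrib_left by (subst sum.swap) simp
  also have "(\<Sum>d\<in>{1..n}. p d * (\<Sum>a\<in>{1..<L}. e (?s d a))) = (\<Sum>d\<in>{1..n}. p d * (\<Sum>a<L. e (?s d a)))"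
    using all by simp
  finally have "real (L - 1) = (\<Sum>d\<in>{1..n}. p d) * sum e {..<L} - (\<Sum>d\<in>{1..n}. p d * (\<Sum>a<L. e (?s d a)))"
    unfolding sum_p by simp
  also have "\<dots> = (\<Sum>d\<in>{1..n}. p d * (sum e {..<L} - (\<Sum>a<L. e (?s d a))))"
    by (simp add: sum_distrib_right sum_subtractf right_diff_distrib)
  \<comment> \<open>Draws d \<ge> L move no position below L, so their terms vanish.\<close>
  also have "\<dots> = (\<Sum>d\<in>{1..<L}. p d * (sum e {..<L} - (\<Sum>a<L. e (?s d a))))"
    using assms by (intro sum.mono_neutral_right) (auto intro!: sum.cong)
  also have "\<dots> = (\<Sum>d\<in>{1..<L}. p d * (sum e {..<L} - sum e {..<d} - sum e {..<L - d}))"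
    by (intro sum.cong refl) (simp add: prefix_sum_split)
  finally show ?thesis by simp
qed

text \<open>Under the same averaging, \<open>L * potential L / 16\<close> loses at most L / 2 while
  the prefix sum loses exactly L - 1, and L / 2 \<le> L - 1 once L \<ge> 2. The factor 16 is twice
  the drop bound 8.\<close>

lemma prefix_sum_ge_potential:
  assumes "0 < L" "L \<le> Suc n"
  shows "real L * potential L / 16 \<le> sum e {..<L}"
  using assms
proof (induction L rule: less_induct)
  case (less L)
  define G where "G L = real L * potential L / 16" for L
  define S where "S L = sum e {..<L}" for L
  show ?case
  proof (cases "L = 1")
    case True
    then show ?thesis by (simp add: potential_def e_0)
  next
    case False
    then have L2: "2 \<le> L" using less.prems by simp
    have rec: "(\<Sum>d\<in>{1..<L}. p d * (S L - S d - S (L - d))) = real (L - 1)"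
      unfolding S_def using less.prems by (rule prefix_sum_recurrence)
    \<comment> \<open>Because d + (L - d) = L, the weighted drop is a difference of products of
      length and potential.\<close>
    have G: "real d * (potential L - potential d) + real (L - d) * (potential L - potential (L - d))
        = 16 * (G L - G d - G (L - d))" if "d \<in> {1..<L}" for d
      using that by (simp add: G_def of_nat_diff field_simps)
    have "(\<Sum>d\<in>{1..<L}. p d * (real d * (potential L - potential d)
            + real (L - d) * (potential L - potential (L - d))))
        = 16 * (\<Sum>d\<in>{1..<L}. p d * (G L - G d - G (L - d)))"
      unfolding sum_distrib_left by (intro sum.cong refl) (simp only: G mult.left_commute)
    then have "(\<Sum>d\<in>{1..<L}. p d * (G L - G d - G (L - d))) \<le> real L / 2"
      using expected_potential_drop_le[OF less.prems] by simp
    also have "\<dots> \<le> real (L - 1)" using L2 by (simp add: of_nat_diff)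
    also have "\<dots> \<le> (\<Sum>d\<in>{1..<L}. p d * (S L - G d - G (L - d)))"
      unfolding rec[symmetric]
    proof (intro sum_mono mult_left_mono p_nonneg)
      fix d assume d: "d \<in> {1..<L}"
      then have "G d \<le> S d" "G (L - d) \<le> S (L - d)"
        unfolding G_def S_def using less.prems less.IH[of d] less.IH[of "L - d"] by auto
      then show "S L - S d - S (L - d) \<le> S L - G d - G (L - d)" by simp
    qed
    finally have "0 \<le> (\<Sum>d\<in>{1..<L}. p d * (S L - G L))"
      by (simp add: sum_subtractf right_diff_distrib)
    then have "0 \<le> (\<Sum>d\<in>{1..<L}. p d) * (S L - G L)" by (simp add: sum_distrib_right)
    \<comment> \<open>If all draws below L had weight 0, the recurrence would read 0 = L -
      1.\<close>
    moreover have "0 < (\<Sum>d\<in>{1..<L}. p d)"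
    proof (rule ccontr)
      assume "\<not> 0 < (\<Sum>d\<in>{1..<L}. p d)"
      then have "(\<Sum>d\<in>{1..<L}. p d) = 0" by (simp add: sum_nonneg p_nonneg order_antisym)
      then have "\<forall>d\<in>{1..<L}. p d = 0" by (subst (asm) sum_nonneg_eq_0_iff) (auto intro: p_nonneg)
      then show False using rec L2 by simp
    qed
    ultimately show ?thesis by (simp add: zero_le_mult_iff S_def G_def)
  qed
qed

lemma sum_expected_times_ge:
  assumes "0 < n"
  shows "real n * (ln (real n))\<^sup>2 / 96 \<le> (\<Sum>a\<in>{1..n}. e a)"
proof -
  \<comment> \<open>Length n + 1 covers the positions 0 to n, and the term at 0 vanishes; 96 is 6 *
    16.\<close>
  have "real n * ((ln (real n))\<^sup>2 / 6) \<le> real (Suc n) * potential (Suc n)"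
    using potential_ge[OF assms] by (intro mult_mono) auto
  also have "\<dots> \<le> 16 * sum e {..<Suc n}" using prefix_sum_ge_potential[of "Suc n"] by simp
  also have "{..<Suc n} = insert 0 {1..n}" by auto
  finally show ?thesis by (simp add: e_0)
qed

end

end

section \<open>First-step analysis of the hitting time\<close>

definition expected_time_from :: "nat pmf \<Rightarrow> nat \<Rightarrow> ennreal" where
  "expected_time_from \<mu> a = (\<integral>\<^sup>+ ds. ennreal_of_enat (hitting_time a ds) \<partial>stream_space (measure_pmf \<mu>))"

text \<open>\<open>chain\<close> recurses on the last draw, whereas the first-step equations
  condition on the first one.\<close>

lemma chain_SCons:
  "chain a (d ## ds) (Suc t) = chain (if d \<le> a then a - d else a) ds t"
  by (induction t) simp_all

lemma hitting_time_0: "hitting_time 0 ds = 0"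
proof -
  have "chain 0 ds 0 = 0" by simp
  then show ?thesis unfolding hitting_time_def
    by (metis (lifting) Least_eq_0 zero_enat_def)
qed

text \<open>From a positive start time 0 is not a hit, so removing the first draw lowers the least
  hitting time by exactly one. Without any hit both sides are infinite.\<close>

lemma hitting_time_SCons:
  assumes "0 < a"
  shows "hitting_time a (d ## ds) = eSuc (hitting_time (if d \<le> a then a - d else a) ds)"
proof -
  let ?b = "if d \<le> a then a - d else a"
  have ex: "(\<exists>t. chain a (d ## ds) t = 0) \<longleftrightarrow> (\<exists>t. chain ?b ds t = 0)"
    using assms chain_SCons by (metis chain.simps(1) not0_implies_Suc not_gr_zero)
  show ?thesis
  proof (cases "\<exists>t. chain a (d ## ds) t = 0")
    case True
    then obtain t where t: "chain a (d ## ds) t = 0" by blast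
    have "(LEAST t. chain a (d ## ds) t = 0) = Suc (LEAST t. chain a (d ## ds) (Suc t) = 0)"
      using t assms by (intro Least_Suc) auto
    then show ?thesis
      unfolding hitting_time_def using True ex by (simp only: chain_SCons if_True eSuc_enat)
  next
    case False
    then show ?thesis
      unfolding hitting_time_def using ex by (simp only: if_False eSuc_infinity)
  qed
qed

lemma measurable_hitting_time_from:
  "hitting_time a \<in> stream_space (measure_pmf \<mu>) \<rightarrow>\<^sub>M count_space UNIV"
proof -
  have "(\<lambda>ds. (a, ds)) \<in> stream_space (measure_pmf \<mu>) \<rightarrow>\<^sub>M chain_space n \<mu>"
    unfolding chain_space_def by measurable
  from measurable_compose[OF this measurable_hitting_time] show ?thesis by simp
qed

lemma expected_time_from_0: "expected_time_from \<mu> 0 = 0"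
  by (simp add: expected_time_from_def hitting_time_0)

text \<open>Conditions on the first draw: the remaining stream is independent of it and has the same
  law. Working in \<open>ennreal\<close> covers infinite expectations.\<close>

lemma expected_time_from_step:
  assumes "0 < a" "set_pmf \<mu> \<subseteq> {1..n}"
  shows "expected_time_from \<mu> a = 1 + (\<Sum>d\<in>{1..n}. ennreal (pmf \<mu> d)
      * expected_time_from \<mu> (if d \<le> a then a - d else a))"
proof -
  interpret S: prob_space "stream_space (measure_pmf \<mu>)"
    by (rule prob_space.prob_space_stream_space) (rule prob_space_measure_pmf)
  note [measurable] = measurable_hitting_time_from
  let ?S = "stream_space (measure_pmf \<mu>)"
  have "expected_time_from \<mu> a
      = (\<integral>\<^sup>+ d. \<integral>\<^sup>+ ds. ennreal_of_enat (hitting_time a (d ## ds)) \<partial>?S \<partial>measure_pmf \<mu>)"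
    unfolding expected_time_from_def
    by (intro prob_space.nn_integral_stream_space prob_space_measure_pmf) measurable
  also have "\<dots> = (\<integral>\<^sup>+ d. 1 + expected_time_from \<mu> (if d \<le> a then a - d else a) \<partial>measure_pmf \<mu>)"
  proof (rule nn_integral_cong)
    fix d
    show "(\<integral>\<^sup>+ ds. ennreal_of_enat (hitting_time a (d ## ds)) \<partial>?S)
        = 1 + expected_time_from \<mu> (if d \<le> a then a - d else a)"
      unfolding hitting_time_SCons[OF assms(1)] expected_time_from_def ennreal_of_enat_eSuc
      by (subst nn_integral_add) (auto simp: S.emeasure_space_1)
  qed
  also have "\<dots> = 1 + (\<integral>\<^sup>+ d. expected_time_from \<mu> (if d \<le> a then a - d else a) \<partial>measure_pmf \<mu>)"
    by (subst nn_integral_add) auto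
  also have "(\<integral>\<^sup>+ d. expected_time_from \<mu> (if d \<le> a then a - d else a) \<partial>measure_pmf \<mu>)
      = (\<Sum>d\<in>{1..n}. ennreal (pmf \<mu> d) * expected_time_from \<mu> (if d \<le> a then a - d else a))"
    by (subst nn_integral_measure_pmf_support[of "{1..n}"])
       (use assms(2) in \<open>auto simp: mult.commute set_pmf_iff\<close>)
  finally show ?thesis .
qed

text \<open>Tonelli on the product space, with the uniform starting point in the outer
  integral.\<close>

lemma expected_time_eq:
  assumes "0 < n"
  shows "expected_time n \<mu> = (\<Sum>a\<in>{1..n}. expected_time_from \<mu> a) / of_nat n"
proof -
  interpret S: prob_space "stream_space (measure_pmf \<mu>)"
    by (rule prob_space.prob_space_stream_space) (rule prob_space_measure_pmf)
  let ?U = "pmf_of_set {1..n}" and ?S = "stream_space (measure_pmf \<mu>)"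
  have m: "(\<lambda>x. ennreal_of_enat (case x of (a, ds) \<Rightarrow> hitting_time a ds))
      \<in> borel_measurable (measure_pmf ?U \<Otimes>\<^sub>M ?S)"
    using measurable_compose[OF measurable_hitting_time[of n \<mu>], of ennreal_of_enat borel]
    unfolding chain_space_def by simp
  have "expected_time n \<mu>
      = (\<integral>\<^sup>+ x. ennreal_of_enat (case x of (a, ds) \<Rightarrow> hitting_time a ds) \<partial>(measure_pmf ?U \<Otimes>\<^sub>M ?S))"
    unfolding expected_time_def chain_space_def by (simp add: case_prod_beta')
  also have "\<dots> = (\<integral>\<^sup>+ a. expected_time_from \<mu> a \<partial>measure_pmf ?U)"
    unfolding S.nn_integral_fst[OF m, symmetric] expected_time_from_def by simp
  also have "\<dots> = (\<Sum>a\<in>{1..n}. expected_time_from \<mu> a) / of_nat n"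
    using assms by (subst nn_integral_pmf_of_set) auto
  finally show ?thesis .
qed

text \<open>One infinite expectation already makes the average infinite; otherwise all expectations
  from \<open>{1..n}\<close> are finite and the real-valued comparison applies.\<close>

lemma expected_time_ge_ln_sq:
  assumes "0 < n" "set_pmf \<mu> \<subseteq> {1..n}"
  shows "ennreal ((ln (real n))\<^sup>2 / 96) \<le> expected_time n \<mu>"
proof (cases "\<exists>a\<in>{1..n}. expected_time_from \<mu> a = \<infinity>")
  case True
  then have top: "(\<Sum>a\<in>{1..n}. expected_time_from \<mu> a) = \<infinity>" by (simp add: infinity_ennreal_def)
  show ?thesis
    unfolding expected_time_eq[OF assms(1)] top by (simp add: ennreal_top_divide)
next
  case False
  \<comment> \<open>\<open>enn2real\<close> sends infinity to 0, so \<open>e\<close> is known to be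
    faithful only for a \<le> n.\<close>
  define e where "e a = enn2real (expected_time_from \<mu> a)" for a
  have e: "expected_time_from \<mu> a = ennreal (e a)" if "a \<le> n" for a
  proof (cases "a = 0")
    case True
    then show ?thesis by (simp add: e_def expected_time_from_0)
  next
    case False
    with \<open>\<not> (\<exists>a\<in>{1..n}. expected_time_from \<mu> a = \<infinity>)\<close> that show ?thesis
      by (auto simp: e_def less_top[symmetric])
  qed
  have e_nonneg: "0 \<le> e a" for a by (simp add: e_def)
  interpret step_weights "pmf \<mu>" n
  proof
    show "(\<Sum>d\<in>{1..n}. pmf \<mu> d) = 1" using assms by (intro sum_pmf_eq_1) auto
  qed simp
  have "real n * (ln (real n))\<^sup>2 / 96 \<le> (\<Sum>a\<in>{1..n}. e a)"
  proof (rule sum_expected_times_ge)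
    show "e 0 = 0" by (simp add: e_def expected_time_from_0)
    fix a assume a: "a \<in> {1..n}"
    let ?R = "\<Sum>d\<in>{1..n}. pmf \<mu> d * e (if d \<le> a then a - d else a)"
    \<comment> \<open>A move never increases the position, so the new one is still at most
      n.\<close>
    have "expected_time_from \<mu> (if d \<le> a then a - d else a)
        = ennreal (e (if d \<le> a then a - d else a))" for d
      using a by (intro e) auto
    then have "ennreal (e a)
        = 1 + (\<Sum>d\<in>{1..n}. ennreal (pmf \<mu> d) * ennreal (e (if d \<le> a then a - d else a)))"
      using expected_time_from_step[of a \<mu> n] a assms e[of a] by simp
    also have "\<dots> = ennreal (1 + ?R)"
      by (simp add: sum_nonneg e_nonneg ennreal_plus flip: ennreal_mult ennreal_1 del: ennreal_1)
    finally have "ennreal (e a) = ennreal (1 + ?R)" .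
    moreover have "0 \<le> 1 + ?R" by (simp add: e_nonneg sum_nonneg)
    ultimately show "e a = 1 + ?R" by (simp only: ennreal_inj e_nonneg)
  qed (rule assms(1))
  then have "(ln (real n))\<^sup>2 / 96 \<le> (\<Sum>a\<in>{1..n}. e a) / real n"
    using assms by (simp add: field_simps)
  moreover have "expected_time n \<mu> = ennreal ((\<Sum>a\<in>{1..n}. e a) / real n)"
    using assms
    by (simp add: expected_time_eq e e_nonneg sum_nonneg ennreal_of_nat_eq_real_of_nat divide_ennreal)
  ultimately show ?thesis by (simp add: ennreal_leI)
qed

theorem theorem3p1:
  "\<exists>c::real. c > 0 \<and> (\<exists>n\<^sub>0::nat. \<forall>n\<ge>n\<^sub>0. \<forall>\<mu> :: nat pmf. 0 < n \<longrightarrow> set_pmf \<mu> \<subseteq> {1..n} \<longrightarrow>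
     ennreal (c * (log 2 (real n))\<^sup>2) \<le> expected_time n \<mu>)"
proof (intro exI conjI allI impI)
  \<comment> \<open>The factor (ln 2)^2 comes from ln n = ln 2 * log 2 n. The threshold is taken to
    be 0.\<close>
  show "(0::real) < (ln 2)\<^sup>2 / 96" by simp
  fix n :: nat and \<mu> :: "nat pmf"
  assume "0 \<le> n" "0 < n" "set_pmf \<mu> \<subseteq> {1..n}"
  then show "ennreal ((ln 2)\<^sup>2 / 96 * (log 2 (real n))\<^sup>2) \<le> expected_time n \<mu>"
    using expected_time_ge_ln_sq[of n \<mu>] by (simp add: log_def power_divide)
qed

end
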